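(* Consider an unanticipated automation shock at date $\tau$ that expands the measure of automatable tasks from $I$ to $I+\Delta$, where $\Delta>0$ and $N-I-\Delta>1$. For $\beta\in\left(0,\frac1{1+g}\right)$, where $1+g=(N-I)^\theta$, let $W_\tau$ and $\tilde W_\tau$ be welfare at date $\tau$ without and with the shock, as defined in the context. Then, holding all other parameters fixed, there exists a unique threshold $\beta^*\in\left(0,\frac{1}{1+g}\right)$ such that, for every $\beta\in\left(0,\frac1{1+g}\right)$, the shock reduces welfare ($\tilde W_\tau<W_\tau$) if and only if $\beta>\beta^*$.
   Context: Parameters: discount factor $\beta$, $\rho>0$, $m>h>0$, $0<I<N$, $N-I>1$, $\theta\in(0,1)$. At the shock date $\tau$ the CDF of expert skills is exactly Pareto with scale $x_\tau$ and shape $1/\theta$: $F_\tau(q)=1-(q/x_\tau)^{-1/\theta}$ for $q\ge x_\tau$, where $x_\tau>\frac{\rho I}{h^N[(m/h)^I-1]}$ (which guarantees that all active experts automate all automatable tasks, both before and after the shock). Equilibrium allocations with span of control $\ell>1$ (number of novices hired by each active expert, who all inherit her skill) starting from $F_\tau$: the sequences $\{a_t,F_t\}_{t\ge\tau}$ determined by $1=\ell[1-F_t(a_t)]$ and $F_{t+1}(q)=0$ if $q\le a_t$, $F_{t+1}(q)=\ell[F_t(q)-F_t(a_t)]$ if $q>a_t$. No shock: $\{a_t,F_t\}_{t\ge\tau}$ are the allocations with $\ell=N-I$; $S(q)=qm^Ih^{N-I}-\rho I$; welfare is $W_\tau=\sum_{j=\tau}^\infty\beta^{j-\tau}\int_{a_j}^\infty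 S(q)\,dF_j(q)$. Shock: $\{\tilde a_t,\tilde F_t\}_{t\ge\tau}$ are the allocations with $\ell=N-I-\Delta$ starting from the same $\tilde F_\tau=F_\tau$; $\tilde S(q)=qm^{I+\Delta}h^{N-I-\Delta}-\rho(I+\Delta)$; welfare is $\tilde W_\tau=\sum_{j=\tau}^\infty\beta^{j-\tau}\int_{\tilde a_j}^\infty \tilde S(q)\,d\tilde F_j(q)$. *)

theory Defs
  imports "HOL-Analysis.Analysis"
begin

definition pareto_cdf :: "real \<Rightarrow> real \<Rightarrow> real \<Rightarrow> real" where
  "pareto_cdf x k q = (if q \<ge> x then 1 - (q / x) powr (- k) else 0)"

text \<open>Dates are natural numbers; the sequences are constrained from date \<open>\<tau>\<close> on only.\<close>

definition equilibrium_allocation ::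
    "real \<Rightarrow> nat \<Rightarrow> (real \<Rightarrow> real) \<Rightarrow> (nat \<Rightarrow> real) \<Rightarrow> (nat \<Rightarrow> real \<Rightarrow> real) \<Rightarrow> bool" where
  "equilibrium_allocation l \<tau> F0 a F \<longleftrightarrow>
     F \<tau> = F0 \<and>
     (\<forall>t\<ge>\<tau>. 1 = l * (1 - F t (a t)) \<and>
             (\<forall>q. F (Suc t) q = (if q \<le> a t then 0 else l * (F t q - F t (a t)))))"

text \<open>Task measures are real numbers, hence the real exponents.\<close>

definition surplus :: "real \<Rightarrow> real \<Rightarrow> real \<Rightarrow> real \<Rightarrow> real \<Rightarrow> real \<Rightarrow> real" where
  "surplus \<rho> m h N I q = q * m powr I * h powr (N - I) - \<rho> * I"

text \<open>The integral is the Lebesgue-Stieltjes integral with respect to \<open>dF\<^sub>j\<close>, and the series over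
  \<open>j \<ge> \<tau>\<close> is indexed by \<open>n = j - \<tau>\<close>.\<close>

definition welfare ::
    "real \<Rightarrow> (real \<Rightarrow> real) \<Rightarrow> nat \<Rightarrow> (nat \<Rightarrow> real) \<Rightarrow> (nat \<Rightarrow> real \<Rightarrow> real) \<Rightarrow> real" where
  "welfare \<beta> S \<tau> a F =
     (\<Sum>n. \<beta> ^ n * (LINT q : {a (\<tau> + n)<..} | interval_measure (F (\<tau> + n)). S q))"

text \<open>The allocation predicate is satisfiable from a Pareto start, and it pins down the sequences.\<close>

lemma equilibrium_allocation_pareto:
  fixes l x k :: real
  assumes "l > 1" "x > 0" "k > 0"
  defines "y \<equiv> \<lambda>n. x * (l powr (1 / k)) ^ n"
  shows "equilibrium_allocation l \<tau> (pareto_cdf x k)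
           (\<lambda>t. y (Suc (t - \<tau>))) (\<lambda>t. pareto_cdf (y (t - \<tau>)) k)"
proof -
  define G where "G = l powr (1 / k)"
  have G: "G > 1" using assms by (simp add: G_def)
  have Gk: "G powr (- k) = 1 / l"
    using assms by (simp add: G_def powr_powr powr_minus_divide)
  have ypos: "y n > 0" for n using assms G by (simp add: y_def G_def)
  have ySuc: "y (Suc n) = G * y n" for n by (simp add: y_def G_def)
  have yle: "y n \<le> y (Suc n)" for n using ypos[of n] G by (simp add: ySuc)
  have cut: "pareto_cdf (y n) k (y (Suc n)) = 1 - 1 / l" for n
    using yle[of n] ypos[of n] Gk by (simp add: pareto_cdf_def) (simp add: ySuc)
  have step: "pareto_cdf (y (Suc n)) k q =
      (if q \<le> y (Suc n) then 0
       else l * (pareto_cdf (y n) k q - pareto_cdf (y n) k (y (Suc n))))" for n q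
  proof (cases "q > y (Suc n)")
    case False
    then show ?thesis using ypos[of "Suc n"] by (auto simp: pareto_cdf_def)
  next
    case True
    have "q / y n = G * (q / y (Suc n))" using G by (simp add: ySuc)
    then have "(q / y n) powr (- k) = (1 / l) * (q / y (Suc n)) powr (- k)"
      using powr_mult[of G "q / y (Suc n)" "- k"] Gk by simp
    moreover have "y n \<le> q" using True yle[of n] by simp
    ultimately show ?thesis
      unfolding cut using True assms(1) by (simp add: pareto_cdf_def right_diff_distrib)
  qed
  show ?thesis
    unfolding equilibrium_allocation_def
  proof (intro conjI allI impI)
    show "pareto_cdf (y (\<tau> - \<tau>)) k = pareto_cdf x k" by (simp add: y_def)
  next
    fix t
    show "1 = l * (1 - pareto_cdf (y (t - \<tau>)) k (y (Suc (t - \<tau>))))"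
      using assms(1) by (simp only: cut) simp
  next
    fix t q
    assume "\<tau> \<le> t"
    then show "pareto_cdf (y (Suc t - \<tau>)) k q =
        (if q \<le> y (Suc (t - \<tau>)) then 0
         else l * (pareto_cdf (y (t - \<tau>)) k q - pareto_cdf (y (t - \<tau>)) k (y (Suc (t - \<tau>)))))"
      using step by (simp only: Suc_diff_le)
  qed
qed

lemma equilibrium_allocation_unique:
  fixes l x k :: real
  assumes "l > 1" "x > 0" "k > 0"
    and eq: "equilibrium_allocation l \<tau> (pareto_cdf x k) a F"
  shows "F (\<tau> + n) = pareto_cdf (x * (l powr (1 / k)) ^ n) k"
    and "a (\<tau> + n) = x * (l powr (1 / k)) ^ Suc n"
proof -
  define y where "y = (\<lambda>n. x * (l powr (1 / k)) ^ n)"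
  have ypos: "y n > 0" for n using assms by (simp add: y_def)
  have canon: "equilibrium_allocation l \<tau> (pareto_cdf x k)
      (\<lambda>t. y (Suc (t - \<tau>))) (\<lambda>t. pareto_cdf (y (t - \<tau>)) k)"
    unfolding y_def by (rule equilibrium_allocation_pareto[OF assms(1-3)])
  have cutoff: "b = c" if b: "1 = l * (1 - pareto_cdf z k b)" and c: "1 = l * (1 - pareto_cdf z k c)"
    and z: "z > 0" for b c z
  proof -
    have ge: "z \<le> u \<and> (u / z) powr (- k) = 1 / l" if u: "1 = l * (1 - pareto_cdf z k u)" for u
      using u assms(1) by (auto simp: pareto_cdf_def field_simps split: if_splits)
    have "(b / z) powr (- k) = (c / z) powr (- k)" "z \<le> b" "z \<le> c"
      using ge[OF b] ge[OF c] by auto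
    moreover have "((b / z) powr (- k)) powr (- 1 / k) = b / z" "((c / z) powr (- k)) powr (- 1 / k) = c / z"
      using z \<open>z \<le> b\<close> \<open>z \<le> c\<close> assms(3) by (simp_all add: powr_powr)
    ultimately show ?thesis using z by simp
  qed
  have a: "a (\<tau> + n) = y (Suc n)" if F: "F (\<tau> + n) = pareto_cdf (y n) k" for n
  proof (rule cutoff[OF _ _ ypos[of n]])
    show "1 = l * (1 - pareto_cdf (y n) k (a (\<tau> + n)))"
      using eq F unfolding equilibrium_allocation_def by (metis le_add1)
    show "1 = l * (1 - pareto_cdf (y n) k (y (Suc n)))"
      using canon[unfolded equilibrium_allocation_def, THEN conjunct2, rule_format, of "\<tau> + n"] by simp
  qed
  have F: "F (\<tau> + n) = pareto_cdf (y n) k" for n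
  proof (induction n)
    case 0
    show ?case using eq by (simp add: equilibrium_allocation_def y_def)
  next
    case (Suc n)
    show ?case
    proof
      fix q
      show "F (\<tau> + Suc n) q = pareto_cdf (y (Suc n)) k q"
        using eq[unfolded equilibrium_allocation_def, THEN conjunct2, rule_format, of "\<tau> + n"]
          canon[unfolded equilibrium_allocation_def, THEN conjunct2, rule_format, of "\<tau> + n"]
          a[OF Suc] Suc by simp
    qed
  qed
  show "F (\<tau> + n) = pareto_cdf (x * (l powr (1 / k)) ^ n) k" using F by (simp add: y_def)
  show "a (\<tau> + n) = x * (l powr (1 / k)) ^ Suc n" using a[OF F] by (simp add: y_def)
qed

end

theory Submission
  imports Defs "HOL-Probability.Distribution_Functions"
begin

text \<open>
  The skill distribution stays Pareto with a scale growing by the factor \<open>G = l powr \<theta>\<close> per period, so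
  each welfare is of the form \<open>A / (1 - \<beta> G) - B / (1 - \<beta>)\<close>. With \<open>\<beta> < 1 / G\<close> and \<open>G' < G\<close> after the
  shock, clearing the positive denominators of the welfare difference leaves a quadratic in \<open>\<beta>\<close>.
  It is positive at \<open>0\<close>, since the shock raises surplus on impact, and negative at
  \<open>1 / G\<close>, where welfare without the shock blows up; a quadratic with these end signs changes
  sign exactly once in between.
\<close>

section \<open>The Stieltjes measure of a Pareto CDF and its tail integrals\<close>

lemma has_bochner_integral_powr_tail:
  fixes b s :: real
  assumes "b > 0" "s > 1"
  shows "has_bochner_integral lborel (\<lambda>q. indicator {b<..} q * q powr (- s)) (b powr (1 - s) / (s - 1))"
proof -
  have slope: "- ((1 - s) * z / (s - 1)) = z" for z
    using assms by (simp add: field_simps)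
  have "(\<integral>\<^sup>+q. ennreal (q powr (- s)) * indicator {b..} q \<partial>lborel)
      = ennreal (0 - (- (b powr (1 - s) / (s - 1))))"
  proof (rule nn_integral_FTC_atLeast)
    show "((\<lambda>q. - (q powr (1 - s) / (s - 1))) has_real_derivative q powr (- s)) (at q)" if "b \<le> q" for q
      using that assms by (auto intro!: derivative_eq_intros simp: slope)
    have "((\<lambda>q. q powr (1 - s)) \<longlongrightarrow> 0) at_top"
      using assms(2) tendsto_neg_powr[OF _ filterlim_ident, of "1 - s"] by simp
    then show "((\<lambda>q. - (q powr (1 - s) / (s - 1))) \<longlongrightarrow> 0) at_top"
      using tendsto_mult_left[of _ 0 at_top "- (1 / (s - 1))"] by simp
  qed auto
  \<comment> \<open>The fundamental theorem was applied on a closed half-line; the endpoint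
    \<open>b\<close> is a null set.\<close>
  moreover have "AE q in lborel. q \<noteq> b" by (rule AE_lborel_singleton)
  then have "(\<integral>\<^sup>+q. ennreal (indicator {b<..} q * q powr (- s)) \<partial>lborel)
      = (\<integral>\<^sup>+q. ennreal (q powr (- s)) * indicator {b..} q \<partial>lborel)"
    by (intro nn_integral_cong_AE) (auto simp: indicator_def)
  ultimately show ?thesis
    using assms by (intro has_bochner_integral_nn_integral) auto
qed

text \<open>The last factor has the shape of \<open>has_bochner_integral_powr_tail\<close>, so
  integrals against the density reduce to that lemma.\<close>

definition pareto_density :: "real \<Rightarrow> real \<Rightarrow> real \<Rightarrow> real" where
  "pareto_density y k q = k * y powr k * (indicator {y<..} q * q powr (- (k + 1)))"

lemma pareto_density_measurable [measurable]: "pareto_density y k \<in> borel_measurable borel"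
  unfolding pareto_density_def by measurable

lemma pareto_density_nonneg: "k > 0 \<Longrightarrow> 0 \<le> pareto_density y k q"
  by (simp add: pareto_density_def)

lemma emeasure_pareto_density_tail:
  fixes y k b :: real
  assumes "y > 0" "k > 0" "y \<le> b"
  shows "emeasure (density lborel (pareto_density y k)) {b<..} = ennreal ((b / y) powr (- k))"
proof -
  have "has_bochner_integral lborel (\<lambda>q. k * y powr k * (indicator {b<..} q * q powr (- (k + 1))))
      (k * y powr k * (b powr (- k) / k))"
    using has_bochner_integral_powr_tail[of b "k + 1"] assms
    by (intro has_bochner_integral_mult_right) simp_all
  moreover have "k * y powr k * (b powr (- k) / k) = (b / y) powr (- k)"
    using assms by (simp add: powr_divide powr_minus field_simps)
  ultimately have "(\<integral>\<^sup>+q. ennreal (k * y powr k * (indicator {b<..} q * q powr (- (k + 1)))) \<partial>lborel)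
      = ennreal ((b / y) powr (- k))"
    using assms by (subst nn_integral_eq_integral) (auto simp: has_bochner_integral_iff simp del: integral_mult_right_zero)
  \<comment> \<open>As \<open>y \<le> b\<close>, the cut-off of the density at \<open>y\<close> is
    absorbed by the one at \<open>b\<close>.\<close>
  moreover have "ennreal (pareto_density y k q) * indicator {b<..} q
      = ennreal (k * y powr k * (indicator {b<..} q * q powr (- (k + 1))))" for q
    using assms by (auto simp: pareto_density_def indicator_def)
  ultimately show ?thesis by (simp add: emeasure_density)
qed

lemma mono_pareto_cdf:
  fixes y k :: real
  assumes "y > 0" "k > 0" "u \<le> v"
  shows "pareto_cdf y k u \<le> pareto_cdf y k v"
proof (cases "y \<le> u")
  case True
  then have "(v / y) powr (- k) \<le> (u / y) powr (- k)"
    using assms by (intro powr_mono2') (auto simp: divide_right_mono)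
  then show ?thesis using True assms by (simp add: pareto_cdf_def)
next
  case False
  have "(v / y) powr (- k) \<le> 1" if "y \<le> v"
    using that assms powr_mono2'[of "- k" 1 "v / y"] by simp
  then show ?thesis using False by (simp add: pareto_cdf_def)
qed

text \<open>Two real distributions with the same CDF coincide. Only monotonicity is checked on the
  formula: the right continuity and the limits needed for \<open>interval_measure\<close> are
  inherited from \<open>?D\<close>, once its CDF is known to be
  \<open>pareto_cdf y k\<close>.\<close>

lemma interval_measure_pareto_cdf:
  fixes y k :: real
  assumes "y > 0" "k > 0"
  shows "interval_measure (pareto_cdf y k) = density lborel (pareto_density y k)"
    (is "_ = ?D")
proof -
  have below: "emeasure ?D {..u} = 0" if "u \<le> y" for u
    using that by (subst emeasure_density) (auto simp: pareto_density_def indicator_def nn_integral_0_iff_AE)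
  have "emeasure ?D UNIV = emeasure ?D {..y} + emeasure ?D {y<..}"
    by (subst plus_emeasure) (auto intro: arg_cong[where f = "emeasure ?D"])
  also have "\<dots> = 1"
    using below[of y] emeasure_pareto_density_tail[OF assms order_refl] assms by simp
  finally have D: "real_distribution ?D"
    by (intro real_distribution.intro prob_spaceI real_distribution_axioms.intro) auto
  note fin = real_distribution.finite_borel_measure_M[OF D]
  have cdf: "cdf ?D = pareto_cdf y k"
  proof
    fix u
    show "cdf ?D u = pareto_cdf y k u"
    proof (cases "y \<le> u")
      case True
      have "UNIV - {u<..} = {..u}" by auto
      then have "measure ?D {..u} = 1 - measure ?D {u<..}"
        using prob_space.prob_compl[OF real_distribution.axioms(1)[OF D], of "{u<..}"] by simp
      then show ?thesis
        using True emeasure_pareto_density_tail[OF assms True]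
        by (simp add: cdf_def pareto_cdf_def measure_def)
    next
      case False
      then show ?thesis using below[of u] by (simp add: cdf_def pareto_cdf_def measure_def)
    qed
  qed
  have right_cont: "continuous (at_right u) (pareto_cdf y k)" for u
    using finite_borel_measure.cdf_is_right_cont[OF fin] by (simp add: cdf)
  have bot: "(pareto_cdf y k \<longlongrightarrow> 0) at_bot"
    using finite_borel_measure.cdf_lim_at_bot[OF fin] by (simp add: cdf)
  have top: "(pareto_cdf y k \<longlongrightarrow> 1) at_top"
    using real_distribution.cdf_lim_at_top_prob[OF D] by (simp add: cdf)
  have "real_distribution (interval_measure (pareto_cdf y k))"
    by (rule real_distribution_interval_measure[OF mono_pareto_cdf[OF assms] right_cont bot top])
  moreover have "cdf (interval_measure (pareto_cdf y k)) = cdf ?D"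
    unfolding cdf by (rule cdf_interval_measure[OF mono_pareto_cdf[OF assms] right_cont bot])
  ultimately show ?thesis
    by (intro cdf_unique D)
qed

text \<open>Against the density, the linear term becomes a power tail of exponent \<open>k\<close>
  and the constant term one of exponent \<open>k + 1\<close>. The former converges since
  \<open>k > 1\<close>, the case of finite mean.\<close>

lemma set_integral_affine_pareto:
  fixes y k b c d :: real
  assumes "y > 0" "k > 1" "y \<le> b"
  shows "(LINT q : {b<..} | interval_measure (pareto_cdf y k). c * q - d)
      = c * (k / (k - 1) * y powr k * b powr (1 - k)) - d * (b / y) powr (- k)"
proof -
  let ?f = "\<lambda>q. c * k * y powr k * (indicator {b<..} q * q powr (- k))
      - d * k * y powr k * (indicator {b<..} q * q powr (- (k + 1)))"
  have "has_bochner_integral lborel ?f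
      (c * k * y powr k * (b powr (1 - k) / (k - 1)) - d * k * y powr k * (b powr (1 - (k + 1)) / (k + 1 - 1)))"
    using assms
    by (intro has_bochner_integral_diff has_bochner_integral_mult_right
        has_bochner_integral_powr_tail) auto
  moreover have "pareto_density y k q *\<^sub>R (indicator {b<..} q *\<^sub>R (c * q - d)) = ?f q" for q
  proof (cases "b < q")
    case True
    then have "q * q powr (- (k + 1)) = q powr (- k)"
      using assms powr_add[of q 1 "- (k + 1)"] by simp
    then show ?thesis
      using True assms by (simp add: pareto_density_def algebra_simps)
  qed simp
  ultimately have "integral\<^sup>L (density lborel (pareto_density y k)) (\<lambda>q. indicator {b<..} q *\<^sub>R (c * q - d))
      = c * k * y powr k * (b powr (1 - k) / (k - 1)) - d * k * y powr k * (b powr (1 - (k + 1)) / (k + 1 - 1))"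
    using assms by (subst integral_density) (auto simp: pareto_density_nonneg has_bochner_integral_iff)
  also have "\<dots> = c * (k / (k - 1) * y powr k * b powr (1 - k)) - d * (b / y) powr (- k)"
    using assms by (simp add: powr_divide powr_minus) (simp add: field_simps)
  finally show ?thesis
    using assms by (simp add: set_lebesgue_integral_def interval_measure_pareto_cdf)
qed

section \<open>Welfare as a difference of two geometric series\<close>

text \<open>In each period the mass of active experts is \<open>1 / l\<close>, while their total
  skill grows by the factor \<open>l powr \<theta>\<close>. The first term therefore sums with ratio
  \<open>\<beta> * l powr \<theta>\<close>, the second with ratio \<open>\<beta>\<close>.\<close>

lemma welfare_pareto:
  fixes l x \<theta> \<beta> c d :: real
  assumes "l > 1" "x > 0" "0 < \<theta>" "\<theta> < 1" "0 \<le> \<beta>" "\<beta> * l powr \<theta> < 1"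
    and S: "\<And>q. S q = c * q - d"
    and eq: "equilibrium_allocation l \<tau> (pareto_cdf x (1 / \<theta>)) a F"
  shows "welfare \<beta> S \<tau> a F
      = c * x * l powr (\<theta> - 1) / (1 - \<theta>) / (1 - \<beta> * l powr \<theta>) - d / l / (1 - \<beta>)"
proof -
  define G where "G = l powr \<theta>"
  have G: "G > 1" using assms by (simp add: G_def)
  have F: "F (\<tau> + n) = pareto_cdf (x * G ^ n) (1 / \<theta>)" and a: "a (\<tau> + n) = x * G ^ Suc n" for n
    using equilibrium_allocation_unique[OF assms(1,2) _ eq] assms by (auto simp: G_def)
  have int: "(LINT q : {a (\<tau> + n)<..} | interval_measure (F (\<tau> + n)). S q)
      = c * x * l powr (\<theta> - 1) / (1 - \<theta>) * G ^ n - d / l" for n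
  proof -
    let ?y = "x * G ^ n"
    have y: "?y > 0" using assms G by simp
    \<comment> \<open>The cut-off is \<open>G\<close> times the scale \<open>?y\<close>, so this is
      the mass above the cut-off.\<close>
    have Gk: "G powr (- (1 / \<theta>)) = 1 / l"
      using assms by (simp add: G_def powr_powr powr_minus_divide)
    \<comment> \<open>The exponents of \<open>?y\<close> add up to one, so the date enters the skill
      integral only through the factor \<open>?y\<close>.\<close>
    have "?y powr (1 / \<theta>) * (G * ?y) powr (1 - 1 / \<theta>)
        = (?y powr (1 / \<theta>) * ?y powr (1 - 1 / \<theta>)) * G powr (1 - 1 / \<theta>)"
      using y G by (simp add: powr_mult)
    also have "?y powr (1 / \<theta>) * ?y powr (1 - 1 / \<theta>) = ?y"
      using y powr_add[of ?y "1 / \<theta>" "1 - 1 / \<theta>"] by simp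
    also have "G powr (1 - 1 / \<theta>) = l powr (\<theta> - 1)"
      using assms by (simp add: G_def powr_powr right_diff_distrib)
    finally have pw: "?y powr (1 / \<theta>) * (G * ?y) powr (1 - 1 / \<theta>) = ?y * l powr (\<theta> - 1)" .
    have "(LINT q : {a (\<tau> + n)<..} | interval_measure (F (\<tau> + n)). S q)
        = (LINT q : {G * ?y<..} | interval_measure (pareto_cdf ?y (1 / \<theta>)). c * q - d)"
      by (simp add: S F a mult_ac)
    also have "\<dots> = c * (1 / \<theta> / (1 / \<theta> - 1) * ?y powr (1 / \<theta>) * (G * ?y) powr (1 - 1 / \<theta>))
        - d * (G * ?y / ?y) powr (- (1 / \<theta>))"
      using y G assms by (intro set_integral_affine_pareto) auto
    also have "\<dots> = c * (1 / \<theta> / (1 / \<theta> - 1) * (?y * l powr (\<theta> - 1))) - d * (1 / l)"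
      using y by (simp only: nonzero_mult_div_cancel_right Gk pw mult.assoc less_imp_neq[OF y, symmetric] not_False_eq_True)
    also have "1 / \<theta> / (1 / \<theta> - 1) = 1 / (1 - \<theta>)"
      using assms by (simp add: field_simps)
    finally show ?thesis by (simp add: field_simps)
  qed
  have "\<beta> < 1"
    using assms(5,6) G mult_left_mono[of 1 G \<beta>] by (simp add: G_def)
  have "(\<lambda>n. c * x * l powr (\<theta> - 1) / (1 - \<theta>) * (\<beta> * G) ^ n - d / l * \<beta> ^ n)
      sums (c * x * l powr (\<theta> - 1) / (1 - \<theta>) * (1 / (1 - \<beta> * G)) - d / l * (1 / (1 - \<beta>)))"
    using assms G \<open>\<beta> < 1\<close>
    by (intro sums_diff sums_mult geometric_sums) (auto simp: G_def abs_mult)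
  then show ?thesis
    by (simp add: welfare_def int sums_iff right_diff_distrib power_mult_distrib mult_ac G_def)
qed

section \<open>A single sign change of a quadratic\<close>

text \<open>Splitting off a root \<open>s\<close> between the endpoints leaves an affine cofactor
  \<open>L\<close>. The end signs of \<open>Q\<close> make \<open>L\<close> negative at both ends,
  hence in between, so \<open>Q\<close> has the sign of \<open>s - t\<close>.\<close>

lemma quadratic_unique_sign_change:
  fixes p q r d :: real
  defines "Q \<equiv> \<lambda>t. p * t\<^sup>2 + q * t + r"
  assumes "d > 0" "Q 0 > 0" "Q d < 0"
  shows "\<exists>s\<in>{0<..<d}. \<forall>t\<in>{0<..<d}. Q t < 0 \<longleftrightarrow> s < t"
proof -
  have "continuous_on {0..d} Q"
    unfolding Q_def by (intro continuous_intros)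
  then obtain s where s: "0 \<le> s" "s \<le> d" "Q s = 0"
    using IVT2'[of Q d 0 0] assms by auto
  then have "s \<noteq> 0" "s \<noteq> d" using assms(3,4) by auto
  with s have s0: "0 < s" "s < d" by auto
  define L where "L t = p * (t + s) + q" for t
  have Q: "Q t = (t - s) * L t" for t
    using s(3) by (simp add: Q_def L_def algebra_simps power2_eq_square)
  have L0: "L 0 < 0" using assms(3) s0 by (simp add: Q zero_less_mult_iff mult_less_0_iff)
  have Ld: "L d < 0" using assms(4) s0 by (simp add: Q mult_less_0_iff)
  have L: "L t < 0" if "0 < t" "t < d" for t
  proof -
    \<comment> \<open>An affine function interpolates its end values.\<close>
    have "d * L t = (d - t) * L 0 + t * L d"
      by (simp add: L_def algebra_simps)
    moreover have "(d - t) * L 0 < 0" "t * L d < 0"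
      using that L0 Ld by (simp_all add: mult_less_0_iff)
    ultimately have "d * L t < 0" by linarith
    then show ?thesis using assms(2) by (simp add: mult_less_0_iff)
  qed
  have "Q t < 0 \<longleftrightarrow> s < t" if "t \<in> {0<..<d}" for t
    using L[of t] that by (auto simp: Q mult_less_0_iff)
  then show ?thesis using s0 by auto
qed

section \<open>The surplus gain at the shock date\<close>

text \<open>Convexity of \<open>r powr t\<close> in \<open>t\<close>: the chord over
  \<open>[0, u]\<close> is at most as steep as the tangent at \<open>u\<close>, of slope
  \<open>r powr u * ln r\<close>, and that at most as steep as the chord over
  \<open>[u, u + v]\<close>. Both comparisons come from \<open>1 + z \<le> exp z\<close>.\<close>

lemma powr_chord_slope_le:
  fixes r u v :: real
  assumes "r > 1" "u > 0" "v > 0"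
  shows "v * (r powr u - 1) \<le> u * (r powr u * (r powr v - 1))"
proof -
  have lower: "1 - r powr (- u) \<le> u * ln r"
    using assms exp_ge_add_one_self[of "- (u * ln r)"] by (simp add: powr_def)
  have upper: "v * ln r \<le> r powr v - 1"
    using exp_ge_add_one_self[of "v * ln r"] assms(1) by (simp add: powr_def algebra_simps)
  have "v * (r powr u - 1) = v * r powr u * (1 - r powr (- u))"
    using assms by (simp add: powr_minus field_simps)
  also have "\<dots> \<le> v * r powr u * (u * ln r)"
    using assms lower by (intro mult_left_mono) auto
  also have "\<dots> = u * r powr u * (v * ln r)" by simp
  also have "\<dots> \<le> u * r powr u * (r powr v - 1)"
    using assms upper by (intro mult_left_mono) auto
  finally show ?thesis by (simp add: mult.assoc)
qed

text \<open>The derivative in the span is \<open>z powr (- 2) - z powr (\<theta> - 2)\<close>, which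
  is nonpositive for \<open>z \<ge> 1\<close>. Times \<open>x\<close>, the expression is the
  integral of \<open>q - x\<close> over the experts active at the shock date, a set that grows as
  the span falls.\<close>

lemma powr_minus_inverse_antimono:
  fixes \<theta> l l' :: real
  assumes "0 < \<theta>" "\<theta> < 1" "1 \<le> l'" "l' \<le> l"
  shows "l powr (\<theta> - 1) / (1 - \<theta>) - 1 / l \<le> l' powr (\<theta> - 1) / (1 - \<theta>) - 1 / l'"
proof (rule DERIV_nonpos_imp_nonincreasing[OF assms(4)])
  fix z assume z: "l' \<le> z" "z \<le> l"
  then have z1: "1 \<le> z" using assms by simp
  have eq: "(\<theta> - 1) * z powr (\<theta> - 2) / (1 - \<theta>) = - (z powr (\<theta> - 2))"
    using assms by (simp add: field_simps)
  have "((\<lambda>l. l powr (\<theta> - 1) / (1 - \<theta>) - 1 / l) has_real_derivative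
      (\<theta> - 1) * z powr (\<theta> - 2) / (1 - \<theta>) + z powr (- 2)) (at z)"
    using z1 by (auto intro!: derivative_eq_intros simp: powr_minus power2_eq_square divide_inverse)
  moreover have "z powr (- 2) \<le> z powr (\<theta> - 2)"
    using z1 assms by (intro powr_mono) auto
  ultimately show "\<exists>w. ((\<lambda>l. l powr (\<theta> - 1) / (1 - \<theta>) - 1 / l) has_real_derivative w) (at z) \<and> w \<le> 0"
    unfolding eq by (intro exI[of _ "- (z powr (\<theta> - 2)) + z powr (- 2)"]) simp
qed

text \<open>The two sides are the aggregate surpluses at the shock date, the values of the welfare
  formulas at \<open>\<beta> = 0\<close>.\<close>

lemma impact_gain:
  fixes x H \<rho> r I \<Delta> \<theta> l :: real
  assumes "0 < \<rho>" "0 < H" "1 < r" "0 < I" "0 < \<Delta>" "0 < \<theta>" "\<theta> < 1" "1 < l - \<Delta>"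
    and x: "\<rho> * I / (H * (r powr I - 1)) < x"
  shows "H * r powr I * x * l powr (\<theta> - 1) / (1 - \<theta>) - \<rho> * I / l
      < H * r powr (I + \<Delta>) * x * (l - \<Delta>) powr (\<theta> - 1) / (1 - \<theta>) - \<rho> * (I + \<Delta>) / (l - \<Delta>)"
proof -
  define y where "y = H * x"
  define k where "k = l powr (\<theta> - 1) / (1 - \<theta>)"
  define k' where "k' = (l - \<Delta>) powr (\<theta> - 1) / (1 - \<theta>)"
  define u where "u = 1 / l"
  define u' where "u' = 1 / (l - \<Delta>)"
  define s where "s = y * r powr I - \<rho> * I"
  define s' where "s' = y * r powr (I + \<Delta>) - \<rho> * (I + \<Delta>)"
  have rI: "r powr I > 1" and rD: "r powr \<Delta> > 1" using assms by auto
  have y: "\<rho> * I < y * (r powr I - 1)"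
    using x rI assms by (simp add: y_def field_simps)
  have "0 < \<rho> * I" using assms by simp
  then have "0 < y" using y rI by (smt (verit) mult_nonpos_nonneg)
  have s: "0 < s" using y \<open>0 < y\<close> by (simp add: s_def right_diff_distrib)
  \<comment> \<open>The bound on \<open>x\<close> says that at the lowest skill the average output
    gain over the first \<open>I\<close> tasks exceeds the cost \<open>\<rho>\<close> per task. By
    convexity the average gain over the next \<open>\<Delta>\<close> tasks is at least as
    large.\<close>
  have "I * (\<rho> * \<Delta>) = \<Delta> * (\<rho> * I)" by simp
  also have "\<dots> < \<Delta> * (y * (r powr I - 1))"
    using y assms by (intro mult_strict_left_mono) auto
  also have "\<dots> = y * (\<Delta> * (r powr I - 1))" by simp
  also have "\<dots> \<le> y * (I * (r powr I * (r powr \<Delta> - 1)))"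
    using powr_chord_slope_le[of r I \<Delta>] assms \<open>0 < y\<close> by (intro mult_left_mono) auto
  also have "\<dots> = I * (y * (r powr I * (r powr \<Delta> - 1)))" by simp
  finally have "\<rho> * \<Delta> < y * (r powr I * (r powr \<Delta> - 1))"
    using assms by (simp only: mult_less_cancel_left_pos)
  then have ss': "s < s'" by (simp add: s_def s'_def powr_add algebra_simps)
  have uu': "u < u'" "0 < u" using assms by (auto simp: u_def u'_def field_simps)
  have ku: "k - u \<le> k' - u'"
    using powr_minus_inverse_antimono[of \<theta> "l - \<Delta>" l] assms by (simp add: k_def k'_def u_def u'_def)
  \<comment> \<open>This makes the weight \<open>k - u\<close> nonnegative, as the product estimate
    below requires.\<close>
  have "u \<le> k"
  proof -
    have "l powr (- 1) \<le> l powr (\<theta> - 1)" using assms by (intro powr_mono) auto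
    also have "\<dots> \<le> l powr (\<theta> - 1) / (1 - \<theta>)" using assms by (simp add: field_simps)
    finally show ?thesis using assms by (simp add: u_def k_def powr_minus_divide)
  qed
  txt \<open>Here \<open>s\<close> is the surplus at the lowest skill and \<open>u\<close> the mass of active experts; \<open>k - u\<close>
    weighs the skill in excess of the lowest one. All three increase with the shock.\<close>
  have "y * r powr I * k - \<rho> * I * u = y * r powr I * (k - u) + s * u"
    by (simp add: s_def algebra_simps)
  also have "\<dots> \<le> y * r powr (I + \<Delta>) * (k' - u') + s * u"
    using \<open>0 < y\<close> \<open>u \<le> k\<close> ku assms
    by (intro add_right_mono mult_mono) (auto intro!: mult_nonneg_nonneg)
  also have "s * u < s' * u'"
    using ss' uu' s by (intro mult_strict_mono) auto
  also have "y * r powr (I + \<Delta>) * (k' - u') + s' * u' = y * r powr (I + \<Delta>) * k' - \<rho> * (I + \<Delta>) * u'"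
    by (simp add: s'_def algebra_simps)
  finally show ?thesis by (simp add: y_def k_def k'_def u_def u'_def mult_ac)
qed

section \<open>The threshold in the discount factor\<close>

lemma discounted_value_threshold:
  fixes A A' B B' G G' :: real
  assumes "1 < G'" "G' < G" "0 < A" "A - B < A' - B'"
  shows "\<exists>s\<in>{0<..<1 / G}. \<forall>\<beta>\<in>{0<..<1 / G}.
    A' / (1 - \<beta> * G') - B' / (1 - \<beta>) < A / (1 - \<beta> * G) - B / (1 - \<beta>) \<longleftrightarrow> s < \<beta>"
proof -
  \<comment> \<open>\<open>B\<close> and \<open>B'\<close> share the denominator
    \<open>1 - \<beta>\<close>, so only their difference matters. Three distinct linear denominators
    remain, and clearing them leaves two in each term: hence degree two, not three.\<close>
  define K where "K = B' - B"
  let ?Q = "\<lambda>t. (A' * G - A * G' - K * G * G') * t\<^sup>2 + (A * (1 + G') - A' * (1 + G) + K * (G + G')) * t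
    + (A' - A - K)"
  have Q: "?Q t = A' * (1 - t * G) * (1 - t) - A * (1 - t * G') * (1 - t) - K * (1 - t * G) * (1 - t * G')" for t
    by (simp add: algebra_simps power2_eq_square)
  have "?Q 0 > 0" using assms by (simp add: K_def)
  \<comment> \<open>At \<open>1 / G\<close> the factor \<open>1 - t * G\<close> vanishes and only
    the term in \<open>A\<close> survives.\<close>
  moreover have "?Q (1 / G) = - (A * (1 - 1 / G * G') * (1 - 1 / G))"
    unfolding Q using assms by simp
  then have "?Q (1 / G) < 0" using assms by (simp add: zero_less_mult_iff)
  ultimately obtain s where s: "s \<in> {0<..<1 / G}" "\<forall>t\<in>{0<..<1 / G}. ?Q t < 0 \<longleftrightarrow> s < t"
    using quadratic_unique_sign_change[of "1 / G"] assms by (smt (verit) divide_pos_pos)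
  have "A' / (1 - \<beta> * G') - B' / (1 - \<beta>) < A / (1 - \<beta> * G) - B / (1 - \<beta>) \<longleftrightarrow> ?Q \<beta> < 0"
    if \<beta>: "\<beta> \<in> {0<..<1 / G}" for \<beta>
  proof -
    define D D' E where "D = 1 - \<beta> * G" and "D' = 1 - \<beta> * G'" and "E = 1 - \<beta>"
    have "\<beta> * G < 1" using \<beta> assms by (simp add: field_simps)
    moreover have "\<beta> * G' < \<beta> * G" "\<beta> * 1 < \<beta> * G" using \<beta> assms by auto
    ultimately have pos: "0 < D" "0 < D'" "0 < E" by (auto simp: D_def D'_def E_def)
    have "?Q \<beta> = D * D' * E * ((A' / D' - B' / E) - (A / D - B / E))"
    proof -
      have "?Q \<beta> = A' * D * E - A * D' * E - K * D * D'"
        by (simp only: Q D_def D'_def E_def)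
      also have "\<dots> = D * D' * E * ((A' / D' - B' / E) - (A / D - B / E))"
        using pos by (simp add: K_def field_simps)
      finally show ?thesis .
    qed
    moreover have "D * D' * E > 0" using pos by simp
    ultimately have "?Q \<beta> < 0 \<longleftrightarrow> (A' / D' - B' / E) - (A / D - B / E) < 0"
      by (metis mult_less_0_iff not_less_iff_gr_or_eq)
    then show ?thesis by (simp add: D_def D'_def E_def)
  qed
  with s show ?thesis by (intro bexI[of _ s]) auto
qed

theorem proposition5:
  fixes \<rho> m h N I \<Delta> \<theta> g x :: real
    and \<tau> :: nat
    and a a' :: "nat \<Rightarrow> real"
    and F F' :: "nat \<Rightarrow> real \<Rightarrow> real"
  assumes "\<rho> > 0"
    and "h > 0" and "m > h"
    and "0 < I" and "I < N" and "N - I > 1"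
    and "0 < \<theta>" and "\<theta> < 1"
    and "\<Delta> > 0" and "N - I - \<Delta> > 1"
    and "x > \<rho> * I / (h powr N * ((m / h) powr I - 1))"
    and "1 + g = (N - I) powr \<theta>"
    and "equilibrium_allocation (N - I) \<tau> (pareto_cdf x (1 / \<theta>)) a F"
    and "equilibrium_allocation (N - I - \<Delta>) \<tau> (pareto_cdf x (1 / \<theta>)) a' F'"
  shows "\<exists>!\<beta>s. \<beta>s \<in> {0<..<1 / (1 + g)} \<and>
           (\<forall>\<beta>\<in>{0<..<1 / (1 + g)}.
              welfare \<beta> (surplus \<rho> m h N (I + \<Delta>)) \<tau> a' F'
                < welfare \<beta> (surplus \<rho> m h N I) \<tau> a F
              \<longleftrightarrow> \<beta> > \<beta>s)"
proof -
  define l r H where "l = N - I" and "r = m / h" and "H = h powr N"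
  define G G' where "G = l powr \<theta>" and "G' = (l - \<Delta>) powr \<theta>"
  define A where "A = H * r powr I * x * l powr (\<theta> - 1) / (1 - \<theta>)"
  define A' where "A' = H * r powr (I + \<Delta>) * x * (l - \<Delta>) powr (\<theta> - 1) / (1 - \<theta>)"
  define B B' where "B = \<rho> * I / l" and "B' = \<rho> * (I + \<Delta>) / (l - \<Delta>)"
  have l: "1 < l - \<Delta>" "1 < l" using assms by (auto simp: l_def)
  have r: "1 < r" and H: "0 < H" using assms by (auto simp: r_def H_def)
  have x: "\<rho> * I / (H * (r powr I - 1)) < x" using assms by (simp add: H_def r_def)
  moreover have "0 \<le> \<rho> * I / (H * (r powr I - 1))"
    using r H assms by (intro divide_nonneg_nonneg mult_nonneg_nonneg) (auto simp: ge_one_powr_ge_zero)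
  ultimately have "0 < x" by linarith
  have G: "1 < G'" "G' < G"
    using l assms by (auto simp: G_def G'_def intro: powr_less_mono2)
  have "0 < A" using \<open>0 < x\<close> r H l assms by (simp add: A_def)
  have "A - B < A' - B'"
    unfolding A_def A'_def B_def B'_def by (rule impact_gain) (use assms r H l x in auto)
  \<comment> \<open>Since \<open>m powr J * h powr (N - J) = H * r powr J\<close>, automation enters
    only through powers of the ratio \<open>r\<close>.\<close>
  have S: "surplus \<rho> m h N J q = H * r powr J * q - \<rho> * J" for J q
    using assms by (simp add: surplus_def H_def r_def powr_divide powr_diff)
  have W: "welfare \<beta> (surplus \<rho> m h N I) \<tau> a F = A / (1 - \<beta> * G) - B / (1 - \<beta>)"
    and W': "welfare \<beta> (surplus \<rho> m h N (I + \<Delta>)) \<tau> a' F' = A' / (1 - \<beta> * G') - B' / (1 - \<beta>)"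
    if "\<beta> \<in> {0<..<1 / G}" for \<beta>
  proof -
    have \<beta>: "0 \<le> \<beta>" "\<beta> * G < 1" using that G by (auto simp: field_simps)
    \<comment> \<open>The shock lowers the growth factor, so the discount bound of the economy
      without the shock also yields convergence after it.\<close>
    moreover have "\<beta> * G' \<le> \<beta> * G" using \<beta> G by (intro mult_left_mono) auto
    ultimately have "\<beta> * G' < 1" by linarith
    show "welfare \<beta> (surplus \<rho> m h N I) \<tau> a F = A / (1 - \<beta> * G) - B / (1 - \<beta>)"
      unfolding A_def B_def G_def
      by (rule welfare_pareto) (use assms l \<open>0 < x\<close> \<beta> S in \<open>auto simp: G_def l_def\<close>)
    show "welfare \<beta> (surplus \<rho> m h N (I + \<Delta>)) \<tau> a' F' = A' / (1 - \<beta> * G') - B' / (1 - \<beta>)"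
      unfolding A'_def B'_def G'_def
      by (rule welfare_pareto) (use assms l \<open>0 < x\<close> \<beta> \<open>\<beta> * G' < 1\<close> S in \<open>auto simp: G'_def l_def\<close>)
  qed
  have g: "1 + g = G" using assms by (simp add: G_def l_def)
  obtain s where s: "s \<in> {0<..<1 / G}"
      "\<forall>\<beta>\<in>{0<..<1 / G}. welfare \<beta> (surplus \<rho> m h N (I + \<Delta>)) \<tau> a' F'
        < welfare \<beta> (surplus \<rho> m h N I) \<tau> a F \<longleftrightarrow> s < \<beta>"
    using discounted_value_threshold[OF G \<open>0 < A\<close> \<open>A - B < A' - B'\<close>] W W' by auto
  show ?thesis
    unfolding g
  proof (rule ex1I)
    fix z
    assume z: "z \<in> {0<..<1 / G} \<and>
      (\<forall>\<beta>\<in>{0<..<1 / G}. welfare \<beta> (surplus \<rho> m h N (I + \<Delta>)) \<tau> a' F'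
        < welfare \<beta> (surplus \<rho> m h N I) \<tau> a F \<longleftrightarrow> \<beta> > z)"
    \<comment> \<open>Both thresholds lie in the interval: taking \<open>\<beta> = z\<close> rules
      out \<open>s < z\<close>, and \<open>\<beta> = s\<close> rules out
      \<open>z < s\<close>.\<close>
    have "s < \<beta> \<longleftrightarrow> z < \<beta>" if "\<beta> \<in> {0<..<1 / G}" for \<beta>
      using s z that by blast
    then show "z = s" using s(1) z by (meson less_irrefl linorder_less_linear)
  qed (use s in blast)
qed

end
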